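(* Let $R$ be a ring and $(\mathfrak a,M)$ an element of $\operatorname{Hom}(R)$. Then $S_{(R/\mathfrak a,M/\mathfrak a)}$ is a non-zero ring, and if $\psi\colon R\to S_{(R/\mathfrak a,M/\mathfrak a)}$ denotes the composite of the canonical projection $\pi\colon R\to R/\mathfrak a$ and $\chi_{(R/\mathfrak a,M/\mathfrak a)}\colon R/\mathfrak a\to S_{(R/\mathfrak a,M/\mathfrak a)}$, then $\ker(\psi)=\mathfrak a$ and $\psi^{-1}(U(S_{(R/\mathfrak a,M/\mathfrak a)}))=M$. Moreover, for any ring morphism $f\colon R\to S$ such that $\ker(f)\supseteq\mathfrak a$ and $f^{-1}(U(S))\supseteq M$, there is a unique ring morphism $g\colon S_{(R/\mathfrak a,M/\mathfrak a)}\to S$ such that $g\psi=f$.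
   Context: All rings are associative with identity $1\neq 0$ (except that the ring $S_{(R,N)}$ defined below may a priori be the zero ring) and ring morphisms send $1$ to $1$. $U(S)$ denotes the group of two-sided invertible elements of a ring $S$. $\operatorname{Hom}(R)$ denotes the set of all pairs $(\ker(\varphi),\varphi^{-1}(U(S)))$ where $\varphi\colon R\to S$ is a ring morphism into an arbitrary ring $S$. For $(\mathfrak a,M)\in\operatorname{Hom}(R)$, $M/\mathfrak a:=\{m+\mathfrak a\mid m\in M\}\subseteq R/\mathfrak a$. For a ring $R$ and a subset $N\subseteq R$, let $X=\{x_n\mid n\in N\}$ be a set of non-commuting indeterminates in bijection with $N$, and let $R\{X\}$ be the free $R$-ring over $X$: there are a ring morphism $R\to R\{X\}$ and a map $X\to R\{X\}$ such that for every ring $S$, every ring morphism $\psi\colon R\to S$ and every map $\zeta\colon X\to S$, there is a unique ring morphism $R\{X\}\to S$ extending both $\psi$ and $\zeta$ (the indeterminates are not assumed to commute with elements of $R$). Let $I$ be the two-sided ideal of $R\{X\}$ generated by $\{x_nn-1\mid n\in N\}\cup\{nx_n-1\mid n\in N\}$. Put $S_{(R,N)}:=R\{X\}/I$ and let $\chi_{(R,N)}\colon R\to S_{(R,N)}$ be the composite of $R\to R\{X\}$ and the canonical projection; this is the universal $N$-inverting $R$-ring. *)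

theory Defs
  imports "HOL-Algebra.QuotRing"
begin

text \<open>
  Rings in HOL-Algebra are associative and unital, and \<open>ring_hom\<close> preserves \<open>\<one>\<close>,
  but the zero ring is allowed; \<open>nonzero_ring\<close> excludes it.
\<close>

definition nonzero_ring :: "('a, 'm) ring_scheme \<Rightarrow> bool" where
  "nonzero_ring R \<longleftrightarrow> ring R \<and> \<one>\<^bsub>R\<^esub> \<noteq> \<zero>\<^bsub>R\<^esub>"

text \<open>
  HOL cannot quantify over the type carrying the target ring, so that type is a parameter of
  the set of pairs. A statement that assumes \<open>(\<aa>, M) \<in> Hom_pairs TYPE('b) R\<close> with \<open>'b\<close> a
  free type variable covers the pairs coming from morphisms into arbitrary rings.
\<close>

definition Hom_pairs :: "'b itself \<Rightarrow> ('a, 'm) ring_scheme \<Rightarrow> ('a set \<times> 'a set) set" where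
  "Hom_pairs T R =
    {(a_kernel R S \<phi>, \<phi> -` Units S \<inter> carrier R) | (S :: 'b ring) \<phi>.
       nonzero_ring S \<and> \<phi> \<in> ring_hom R S}"

text \<open>
  The free \<open>R\<close>-ring over \<open>X\<close> is built as the term algebra of ring expressions over the
  coefficients in \<open>carrier R\<close> and the indeterminates in \<open>X\<close>, modulo the least congruence
  that validates the ring axioms and makes \<open>Coeff\<close> a ring morphism. Coefficients and
  indeterminates do not commute. The lemmas \<open>ring_free_ring\<close>, \<open>free_ring_const_hom\<close> and
  \<open>free_ring_universal\<close> below establish its universal property.
\<close>

datatype ('a, 'x) free_ring_term =
    Coeff 'a
  | Indet 'x
  | Plus "('a, 'x) free_ring_term" "('a, 'x) free_ring_term"
  | Neg "('a, 'x) free_ring_term"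
  | Times "('a, 'x) free_ring_term" "('a, 'x) free_ring_term"

inductive_set free_ring_terms ::
    "('a, 'm) ring_scheme \<Rightarrow> 'x set \<Rightarrow> ('a, 'x) free_ring_term set"
  for R :: "('a, 'm) ring_scheme" and X :: "'x set" where
  Coeff: "r \<in> carrier R \<Longrightarrow> Coeff r \<in> free_ring_terms R X"
| Indet: "x \<in> X \<Longrightarrow> Indet x \<in> free_ring_terms R X"
| Plus: "\<lbrakk>s \<in> free_ring_terms R X; t \<in> free_ring_terms R X\<rbrakk> \<Longrightarrow> Plus s t \<in> free_ring_terms R X"
| Neg: "s \<in> free_ring_terms R X \<Longrightarrow> Neg s \<in> free_ring_terms R X"
| Times: "\<lbrakk>s \<in> free_ring_terms R X; t \<in> free_ring_terms R X\<rbrakk> \<Longrightarrow> Times s t \<in> free_ring_terms R X"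

inductive_set free_ring_rel ::
    "('a, 'm) ring_scheme \<Rightarrow> 'x set \<Rightarrow> (('a, 'x) free_ring_term \<times> ('a, 'x) free_ring_term) set"
  for R :: "('a, 'm) ring_scheme" and X :: "'x set" where
  refl: "s \<in> free_ring_terms R X \<Longrightarrow> (s, s) \<in> free_ring_rel R X"
| sym: "(s, t) \<in> free_ring_rel R X \<Longrightarrow> (t, s) \<in> free_ring_rel R X"
| trans: "\<lbrakk>(s, t) \<in> free_ring_rel R X; (t, u) \<in> free_ring_rel R X\<rbrakk> \<Longrightarrow> (s, u) \<in> free_ring_rel R X"
| Plus_cong: "\<lbrakk>(s, s') \<in> free_ring_rel R X; (t, t') \<in> free_ring_rel R X\<rbrakk>
    \<Longrightarrow> (Plus s t, Plus s' t') \<in> free_ring_rel R X"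
| Neg_cong: "(s, s') \<in> free_ring_rel R X \<Longrightarrow> (Neg s, Neg s') \<in> free_ring_rel R X"
| Times_cong: "\<lbrakk>(s, s') \<in> free_ring_rel R X; (t, t') \<in> free_ring_rel R X\<rbrakk>
    \<Longrightarrow> (Times s t, Times s' t') \<in> free_ring_rel R X"
| Plus_assoc: "\<lbrakk>s \<in> free_ring_terms R X; t \<in> free_ring_terms R X; u \<in> free_ring_terms R X\<rbrakk>
    \<Longrightarrow> (Plus (Plus s t) u, Plus s (Plus t u)) \<in> free_ring_rel R X"
| Plus_comm: "\<lbrakk>s \<in> free_ring_terms R X; t \<in> free_ring_terms R X\<rbrakk>
    \<Longrightarrow> (Plus s t, Plus t s) \<in> free_ring_rel R X"
| Plus_zero: "s \<in> free_ring_terms R X \<Longrightarrow> (Plus (Coeff \<zero>\<^bsub>R\<^esub>) s, s) \<in> free_ring_rel R X"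
| Plus_Neg: "s \<in> free_ring_terms R X \<Longrightarrow> (Plus (Neg s) s, Coeff \<zero>\<^bsub>R\<^esub>) \<in> free_ring_rel R X"
| Times_assoc: "\<lbrakk>s \<in> free_ring_terms R X; t \<in> free_ring_terms R X; u \<in> free_ring_terms R X\<rbrakk>
    \<Longrightarrow> (Times (Times s t) u, Times s (Times t u)) \<in> free_ring_rel R X"
| one_Times: "s \<in> free_ring_terms R X \<Longrightarrow> (Times (Coeff \<one>\<^bsub>R\<^esub>) s, s) \<in> free_ring_rel R X"
| Times_one: "s \<in> free_ring_terms R X \<Longrightarrow> (Times s (Coeff \<one>\<^bsub>R\<^esub>), s) \<in> free_ring_rel R X"
| distrib_right: "\<lbrakk>s \<in> free_ring_terms R X; t \<in> free_ring_terms R X; u \<in> free_ring_terms R X\<rbrakk>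
    \<Longrightarrow> (Times (Plus s t) u, Plus (Times s u) (Times t u)) \<in> free_ring_rel R X"
| distrib_left: "\<lbrakk>s \<in> free_ring_terms R X; t \<in> free_ring_terms R X; u \<in> free_ring_terms R X\<rbrakk>
    \<Longrightarrow> (Times u (Plus s t), Plus (Times u s) (Times u t)) \<in> free_ring_rel R X"
| Coeff_Plus: "\<lbrakk>a \<in> carrier R; b \<in> carrier R\<rbrakk>
    \<Longrightarrow> (Coeff (a \<oplus>\<^bsub>R\<^esub> b), Plus (Coeff a) (Coeff b)) \<in> free_ring_rel R X"
| Coeff_Times: "\<lbrakk>a \<in> carrier R; b \<in> carrier R\<rbrakk>
    \<Longrightarrow> (Coeff (a \<otimes>\<^bsub>R\<^esub> b), Times (Coeff a) (Coeff b)) \<in> free_ring_rel R X"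

definition free_ring ::
    "('a, 'm) ring_scheme \<Rightarrow> 'x set \<Rightarrow> ('a, 'x) free_ring_term set ring" where
  "free_ring R X =
    \<lparr>carrier = free_ring_terms R X // free_ring_rel R X,
     mult = (\<lambda>A B. \<Union>s\<in>A. \<Union>t\<in>B. free_ring_rel R X `` {Times s t}),
     one = free_ring_rel R X `` {Coeff \<one>\<^bsub>R\<^esub>},
     zero = free_ring_rel R X `` {Coeff \<zero>\<^bsub>R\<^esub>},
     add = (\<lambda>A B. \<Union>s\<in>A. \<Union>t\<in>B. free_ring_rel R X `` {Plus s t})\<rparr>"

definition free_ring_const ::
    "('a, 'm) ring_scheme \<Rightarrow> 'x set \<Rightarrow> 'a \<Rightarrow> ('a, 'x) free_ring_term set" where
  "free_ring_const R X r = free_ring_rel R X `` {Coeff r}"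

definition free_ring_var ::
    "('a, 'm) ring_scheme \<Rightarrow> 'x set \<Rightarrow> 'x \<Rightarrow> ('a, 'x) free_ring_term set" where
  "free_ring_var R X x = free_ring_rel R X `` {Indet x}"

text \<open>
  In \<open>S\<^bsub>(R,N)\<^esub>\<close> the indeterminates are indexed by \<open>N\<close> itself: \<open>x\<^sub>n\<close> is \<open>free_ring_var R N n\<close>.
\<close>

definition inverting_ideal ::
    "('a, 'm) ring_scheme \<Rightarrow> 'a set \<Rightarrow> ('a, 'a) free_ring_term set set" where
  "inverting_ideal R N = (let F = free_ring R N in
     Idl\<^bsub>F\<^esub> ({free_ring_var R N n \<otimes>\<^bsub>F\<^esub> free_ring_const R N n \<ominus>\<^bsub>F\<^esub> \<one>\<^bsub>F\<^esub> | n. n \<in> N} \<union>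
           {free_ring_const R N n \<otimes>\<^bsub>F\<^esub> free_ring_var R N n \<ominus>\<^bsub>F\<^esub> \<one>\<^bsub>F\<^esub> | n. n \<in> N}))"

definition inverting_ring ::
    "('a, 'm) ring_scheme \<Rightarrow> 'a set \<Rightarrow> ('a, 'a) free_ring_term set set ring" where
  "inverting_ring R N = free_ring R N Quot inverting_ideal R N"

definition inverting_map ::
    "('a, 'm) ring_scheme \<Rightarrow> 'a set \<Rightarrow> 'a \<Rightarrow> ('a, 'a) free_ring_term set set" where
  "inverting_map R N r = inverting_ideal R N +>\<^bsub>free_ring R N\<^esub> free_ring_const R N r"

subsection \<open>The universal property of the free ring\<close>

lemma free_ring_rel_terms:
  assumes "ring R" and "(s, t) \<in> free_ring_rel R X"
  shows "s \<in> free_ring_terms R X \<and> t \<in> free_ring_terms R X"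
proof -
  interpret ring R by fact
  show ?thesis
    using assms(2) by induction (auto intro: free_ring_terms.intros)
qed

lemma equiv_free_ring_rel:
  assumes "ring R"
  shows "equiv (free_ring_terms R X) (free_ring_rel R X)"
proof (rule equivI)
  show "free_ring_rel R X \<subseteq> free_ring_terms R X \<times> free_ring_terms R X"
    using free_ring_rel_terms[OF assms] by auto
  show "refl_on (free_ring_terms R X) (free_ring_rel R X)"
    by (auto intro!: refl_onI free_ring_rel.refl)
  show "sym (free_ring_rel R X)"
    by (auto intro!: symI free_ring_rel.sym)
  show "trans (free_ring_rel R X)"
    by (auto intro!: transI intro: free_ring_rel.trans)
qed

lemma free_ring_class_eq_iff:
  assumes "ring R" and "s \<in> free_ring_terms R X" and "t \<in> free_ring_terms R X"
  shows "free_ring_rel R X `` {s} = free_ring_rel R X `` {t} \<longleftrightarrow> (s, t) \<in> free_ring_rel R X"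
  using eq_equiv_class_iff[OF equiv_free_ring_rel[OF assms(1)] assms(2,3)] .

lemma free_ring_add_class:
  assumes "ring R" and "s \<in> free_ring_terms R X" and "t \<in> free_ring_terms R X"
  shows "free_ring_rel R X `` {s} \<oplus>\<^bsub>free_ring R X\<^esub> free_ring_rel R X `` {t} =
    free_ring_rel R X `` {Plus s t}"
proof -
  note eqv = equiv_free_ring_rel[OF assms(1), of X]
  have "congruent2 (free_ring_rel R X) (free_ring_rel R X) (\<lambda>s t. free_ring_rel R X `` {Plus s t})"
    by (auto simp only: congruent2_def intro!: equiv_class_eq[OF eqv] free_ring_rel.Plus_cong)
  from UN_equiv_class2[OF eqv eqv this assms(2,3)] show ?thesis
    by (simp add: free_ring_def)
qed

lemma free_ring_mult_class:
  assumes "ring R" and "s \<in> free_ring_terms R X" and "t \<in> free_ring_terms R X"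
  shows "free_ring_rel R X `` {s} \<otimes>\<^bsub>free_ring R X\<^esub> free_ring_rel R X `` {t} =
    free_ring_rel R X `` {Times s t}"
proof -
  note eqv = equiv_free_ring_rel[OF assms(1), of X]
  have "congruent2 (free_ring_rel R X) (free_ring_rel R X) (\<lambda>s t. free_ring_rel R X `` {Times s t})"
    by (auto simp only: congruent2_def intro!: equiv_class_eq[OF eqv] free_ring_rel.Times_cong)
  from UN_equiv_class2[OF eqv eqv this assms(2,3)] show ?thesis
    by (simp add: free_ring_def)
qed

lemma free_ring_carrierE:
  assumes "A \<in> carrier (free_ring R X)"
  obtains s where "s \<in> free_ring_terms R X" and "A = free_ring_rel R X `` {s}"
  using assms by (auto simp: free_ring_def elim: quotientE)

lemma free_ring_class_carrier:
  "s \<in> free_ring_terms R X \<Longrightarrow> free_ring_rel R X `` {s} \<in> carrier (free_ring R X)"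
  by (auto simp: free_ring_def intro: quotientI)

lemma free_ring_zero: "\<zero>\<^bsub>free_ring R X\<^esub> = free_ring_rel R X `` {Coeff \<zero>\<^bsub>R\<^esub>}"
  and free_ring_one: "\<one>\<^bsub>free_ring R X\<^esub> = free_ring_rel R X `` {Coeff \<one>\<^bsub>R\<^esub>}"
  by (simp_all add: free_ring_def)

theorem ring_free_ring:
  assumes "ring R"
  shows "ring (free_ring R X)"
proof -
  interpret ring R by fact
  note cls = free_ring_add_class[OF assms] free_ring_mult_class[OF assms]
    free_ring_zero free_ring_one free_ring_class_eq_iff[OF assms]
    free_ring_class_carrier free_ring_terms.intros
  show ?thesis
  proof (rule ringI)
    show "abelian_group (free_ring R X)"
    proof (rule abelian_groupI)
      fix A assume "A \<in> carrier (free_ring R X)"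
      then obtain s where s: "s \<in> free_ring_terms R X" "A = free_ring_rel R X `` {s}"
        by (rule free_ring_carrierE)
      then show "\<exists>B\<in>carrier (free_ring R X). B \<oplus>\<^bsub>free_ring R X\<^esub> A = \<zero>\<^bsub>free_ring R X\<^esub>"
        by (intro bexI[of _ "free_ring_rel R X `` {Neg s}"])
          (simp_all add: cls free_ring_rel.Plus_Neg)
    qed (elim free_ring_carrierE, simp add: cls free_ring_rel.Plus_assoc free_ring_rel.Plus_comm
        free_ring_rel.Plus_zero | simp add: cls)+
    show "monoid (free_ring R X)"
      by (rule monoidI)
        (elim free_ring_carrierE, simp add: cls free_ring_rel.Times_assoc free_ring_rel.one_Times
          free_ring_rel.Times_one | simp add: cls)+
  qed (elim free_ring_carrierE,
      simp add: cls free_ring_rel.distrib_left free_ring_rel.distrib_right)+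
qed

theorem free_ring_const_hom:
  assumes "ring R"
  shows "free_ring_const R X \<in> ring_hom R (free_ring R X)"
proof -
  interpret ring R by fact
  show ?thesis
    by (rule ring_hom_memI)
      (simp_all add: free_ring_const_def free_ring_add_class[OF assms]
        free_ring_mult_class[OF assms] free_ring_one free_ring_class_eq_iff[OF assms]
        free_ring_class_carrier free_ring_terms.intros
        free_ring_rel.Coeff_Plus free_ring_rel.Coeff_Times)
qed

lemma free_ring_var_carrier: "x \<in> X \<Longrightarrow> free_ring_var R X x \<in> carrier (free_ring R X)"
  by (auto simp: free_ring_var_def intro: free_ring_class_carrier free_ring_terms.intros)

primrec free_ring_eval ::
    "('b, 'n) ring_scheme \<Rightarrow> ('a \<Rightarrow> 'b) \<Rightarrow> ('x \<Rightarrow> 'b) \<Rightarrow> ('a, 'x) free_ring_term \<Rightarrow> 'b" where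
  "free_ring_eval S \<psi> \<zeta> (Coeff r) = \<psi> r"
| "free_ring_eval S \<psi> \<zeta> (Indet x) = \<zeta> x"
| "free_ring_eval S \<psi> \<zeta> (Plus s t) = free_ring_eval S \<psi> \<zeta> s \<oplus>\<^bsub>S\<^esub> free_ring_eval S \<psi> \<zeta> t"
| "free_ring_eval S \<psi> \<zeta> (Neg s) = \<ominus>\<^bsub>S\<^esub> free_ring_eval S \<psi> \<zeta> s"
| "free_ring_eval S \<psi> \<zeta> (Times s t) = free_ring_eval S \<psi> \<zeta> s \<otimes>\<^bsub>S\<^esub> free_ring_eval S \<psi> \<zeta> t"

lemma free_ring_eval_closed:
  assumes "ring S" and "\<psi> \<in> ring_hom R S" and "\<zeta> \<in> X \<rightarrow> carrier S"
    and "t \<in> free_ring_terms R X"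
  shows "free_ring_eval S \<psi> \<zeta> t \<in> carrier S"
proof -
  interpret S: ring S by fact
  show ?thesis
    using assms(4,2,3) by induction (auto simp: ring_hom_closed)
qed

lemma free_ring_eval_rel:
  assumes "ring R" and "ring S" and "\<psi> \<in> ring_hom R S" and "\<zeta> \<in> X \<rightarrow> carrier S"
    and "(s, t) \<in> free_ring_rel R X"
  shows "free_ring_eval S \<psi> \<zeta> s = free_ring_eval S \<psi> \<zeta> t"
proof -
  interpret R: ring R by fact
  interpret S: ring S by fact
  note cl = free_ring_eval_closed[OF assms(2,3,4)]
  show ?thesis
    using assms(5)
    by induction
      (auto simp: cl S.a_ac S.m_assoc S.l_neg S.r_neg S.l_distr S.r_distr
        ring_hom_zero[OF assms(3,1,2)] ring_hom_one[OF assms(3)]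
        ring_hom_add[OF assms(3)] ring_hom_mult[OF assms(3)])
qed

theorem free_ring_universal:
  assumes "ring R" and "ring S" and "\<psi> \<in> ring_hom R S" and "\<zeta> \<in> X \<rightarrow> carrier S"
  shows "\<exists>!h. h \<in> ring_hom (free_ring R X) S \<inter> extensional (carrier (free_ring R X)) \<and>
    (\<forall>r\<in>carrier R. h (free_ring_const R X r) = \<psi> r) \<and>
    (\<forall>x\<in>X. h (free_ring_var R X x) = \<zeta> x)"
proof -
  interpret R: ring R by fact
  interpret S: ring S by fact
  interpret F: ring "free_ring R X" by (rule ring_free_ring[OF assms(1)])
  note cls = free_ring_add_class[OF assms(1)] free_ring_mult_class[OF assms(1)]
    free_ring_zero free_ring_one free_ring_class_eq_iff[OF assms(1)]
    free_ring_class_carrier free_ring_terms.intros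
  note cl = free_ring_eval_closed[OF assms(2,3,4)]
  define h where
    "h = restrict (\<lambda>A. the_elem (free_ring_eval S \<psi> \<zeta> ` A)) (carrier (free_ring R X))"
  have h: "h (free_ring_rel R X `` {s}) = free_ring_eval S \<psi> \<zeta> s"
    if s: "s \<in> free_ring_terms R X" for s
  proof -
    have "free_ring_eval S \<psi> \<zeta> ` (free_ring_rel R X `` {s}) = {free_ring_eval S \<psi> \<zeta> s}"
    proof (intro equalityI subsetI)
      fix y assume "y \<in> free_ring_eval S \<psi> \<zeta> ` (free_ring_rel R X `` {s})"
      then obtain t where "(s, t) \<in> free_ring_rel R X" "y = free_ring_eval S \<psi> \<zeta> t"
        by blast
      then show "y \<in> {free_ring_eval S \<psi> \<zeta> s}"
        using free_ring_eval_rel[OF assms] by (metis singletonI)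
    qed (use free_ring_rel.refl[OF s] in blast)
    then show ?thesis
      using s by (simp add: h_def free_ring_class_carrier)
  qed
  show ?thesis
  proof (rule ex1I[of _ h], intro conjI ballI IntI)
    show "h \<in> ring_hom (free_ring R X) S"
    proof (rule ring_hom_memI)
      show "h \<one>\<^bsub>free_ring R X\<^esub> = \<one>\<^bsub>S\<^esub>"
        using h[OF free_ring_terms.Coeff[OF R.one_closed]] ring_hom_one[OF assms(3)]
        by (simp add: cls)
    qed (elim free_ring_carrierE, simp add: cls h cl)+
    show "h \<in> extensional (carrier (free_ring R X))"
      by (simp add: h_def)
    show "h (free_ring_const R X r) = \<psi> r" if "r \<in> carrier R" for r
      using that by (simp add: free_ring_const_def h free_ring_terms.intros)
    show "h (free_ring_var R X x) = \<zeta> x" if "x \<in> X" for x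
      using that by (simp add: free_ring_var_def h free_ring_terms.intros)
  next
    fix k
    assume k: "k \<in> ring_hom (free_ring R X) S \<inter> extensional (carrier (free_ring R X)) \<and>
      (\<forall>r\<in>carrier R. k (free_ring_const R X r) = \<psi> r) \<and>
      (\<forall>x\<in>X. k (free_ring_var R X x) = \<zeta> x)"
    then have hom: "k \<in> ring_hom (free_ring R X) S" by blast
    have ev: "k (free_ring_rel R X `` {s}) = free_ring_eval S \<psi> \<zeta> s"
      if "s \<in> free_ring_terms R X" for s
      using that
    proof induction
      case (Plus s t)
      then show ?case
        using ring_hom_add[OF hom, of "free_ring_rel R X `` {s}" "free_ring_rel R X `` {t}"]
        by (simp add: cls free_ring_class_carrier)
    next
      case (Times s t)
      then show ?case
        using ring_hom_mult[OF hom, of "free_ring_rel R X `` {s}" "free_ring_rel R X `` {t}"]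
        by (simp add: cls free_ring_class_carrier)
    next
      case (Neg s)
      have "free_ring_rel R X `` {Neg s} \<oplus>\<^bsub>free_ring R X\<^esub> free_ring_rel R X `` {s} =
          \<zero>\<^bsub>free_ring R X\<^esub>"
        using Neg(1) by (simp add: cls free_ring_rel.Plus_Neg)
      then have "k (free_ring_rel R X `` {Neg s}) \<oplus>\<^bsub>S\<^esub> k (free_ring_rel R X `` {s}) = \<zero>\<^bsub>S\<^esub>"
        using ring_hom_add[OF hom, of "free_ring_rel R X `` {Neg s}" "free_ring_rel R X `` {s}"]
          ring_hom_zero[OF hom F.ring_axioms assms(2)] Neg(1)
        by (simp add: free_ring_class_carrier free_ring_terms.Neg)
      moreover have "k (free_ring_rel R X `` {Neg s}) \<in> carrier S"
        using ring_hom_closed[OF hom free_ring_class_carrier[OF free_ring_terms.Neg[OF Neg(1)]]] .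
      ultimately show ?case
        using Neg cl[OF Neg(1)] by (simp add: S.minus_equality)
    qed (use k in \<open>auto simp: free_ring_const_def free_ring_var_def\<close>)
    show "k = h"
    proof (rule extensionalityI[of _ "carrier (free_ring R X)"])
      fix A assume "A \<in> carrier (free_ring R X)"
      then show "k A = h A"
        by (auto elim!: free_ring_carrierE simp: ev h)
    qed (use k in \<open>auto simp: h_def\<close>)
  qed
qed

end

theory Submission
  imports Defs
begin

text \<open>
  The ring \<open>L = S\<^bsub>(R/\<aa>,M/\<aa>)\<^esub>\<close> is the universal target of morphisms out of \<open>R\<close> that kill \<open>\<aa>\<close> and
  make the elements of \<open>M\<close> invertible. Indeed, such a morphism factors uniquely through the quotient
  \<open>R/\<aa>\<close> (\<open>quotient_universal\<close>), and a morphism out of \<open>R/\<aa>\<close> that makes \<open>M/\<aa>\<close> invertible factors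
  uniquely through \<open>L\<close> (\<open>inverting_ring_universal\<close>). The second step sends \<open>x\<^sub>n\<close> to the inverse of
  the image of \<open>n\<close>; there is no other choice because two-sided inverses are unique.

  A universal construction bounds the kernel of \<open>\<psi> : R \<rightarrow> L\<close> and the preimage of the units from below
  only: \<open>\<psi>\<close> kills \<open>\<aa>\<close> and inverts \<open>M\<close>, but it might do more, and \<open>L\<close> might even collapse to zero.
  The assumption that \<open>(\<aa>, M)\<close> comes from some morphism \<open>\<phi> : R \<rightarrow> T\<close> into a nonzero ring excludes
  this. That \<open>\<phi>\<close> kills \<open>\<aa>\<close> and inverts \<open>M\<close>, so \<open>\<phi> = g \<circ> \<psi>\<close> for a morphism \<open>g : L \<rightarrow> T\<close>. Then
  \<open>g \<one> = \<one> \<noteq> \<zero>\<close> shows that \<open>L\<close> is nonzero; whatever \<open>\<psi>\<close> kills is killed by \<open>\<phi>\<close>, hence lies in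
  \<open>\<aa>\<close>; and whatever \<open>\<psi>\<close> inverts is inverted by \<open>\<phi>\<close>, hence lies in \<open>M\<close>.
\<close>

lemma ring_hom_Units:
  assumes "ring R" and "ring S" and "h \<in> ring_hom R S" and "u \<in> Units R"
  shows "h u \<in> Units S"
proof -
  interpret R: ring R by fact
  from assms(4) obtain v where v: "u \<in> carrier R" "v \<in> carrier R"
      "v \<otimes>\<^bsub>R\<^esub> u = \<one>\<^bsub>R\<^esub>" "u \<otimes>\<^bsub>R\<^esub> v = \<one>\<^bsub>R\<^esub>"
    by (auto simp: Units_def)
  then have "h v \<otimes>\<^bsub>S\<^esub> h u = \<one>\<^bsub>S\<^esub>" "h u \<otimes>\<^bsub>S\<^esub> h v = \<one>\<^bsub>S\<^esub>"
    by (metis assms(3) ring_hom_mult ring_hom_one)+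
  then show ?thesis
    using v ring_hom_closed[OF assms(3)] by (auto simp: Units_def)
qed

lemma quotient_carrierE:
  assumes "A \<in> carrier (R Quot I)"
  obtains r where "r \<in> carrier R" and "A = I +>\<^bsub>R\<^esub> r"
  using assms by (auto simp: FactRing_simps)

text \<open>
  The hypothesis is only \<open>I \<subseteq> ker h\<close>; so \<open>h\<close> is constant on cosets of \<open>I\<close>, although a fibre of
  \<open>h\<close> may consist of several of them.
\<close>

lemma (in ring_hom_ring) quotient_universal:
  assumes "ideal I R" and "I \<subseteq> a_kernel R S h"
  shows "\<exists>!g. g \<in> ring_hom (R Quot I) S \<inter> extensional (carrier (R Quot I)) \<and>
    (\<forall>r\<in>carrier R. g (I +> r) = h r)"
proof -
  interpret I: ideal I R by fact
  note pi = I.rcos_ring_hom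
  define g where "g = restrict (\<lambda>A. the_elem (h ` A)) (carrier (R Quot I))"
  have g: "g (I +> r) = h r" if r: "r \<in> carrier R" for r
  proof -
    have "h x = h r" if "x \<in> I +> r" for x
      using that assms(2) by (intro rcos_imp_homeq[OF r]) (auto simp: a_r_coset_def')
    moreover have "r \<in> I +> r"
      using r by (rule I.a_rcos_self)
    ultimately have "h ` (I +> r) = {h r}"
      by blast
    then show ?thesis
      using ring_hom_closed[OF pi r] by (simp add: g_def)
  qed
  show ?thesis
  proof (rule ex1I[of _ g], intro conjI IntI ballI)
    show "g \<in> ring_hom (R Quot I) S"
    proof (rule ring_hom_memI)
      show "g \<one>\<^bsub>R Quot I\<^esub> = \<one>\<^bsub>S\<^esub>"
        using g[OF R.one_closed] ring_hom_one[OF pi] by simp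
    qed (elim quotient_carrierE,
        simp add: g flip: ring_hom_mult[OF pi] ring_hom_add[OF pi])+
  next
    fix k
    assume k: "k \<in> ring_hom (R Quot I) S \<inter> extensional (carrier (R Quot I)) \<and>
      (\<forall>r\<in>carrier R. k (I +> r) = h r)"
    show "k = g"
    proof (rule extensionalityI[of _ "carrier (R Quot I)"])
      fix A assume "A \<in> carrier (R Quot I)"
      then show "k A = g A"
        using k by (auto elim!: quotient_carrierE simp: g)
    qed (use k in \<open>auto simp: g_def\<close>)
  qed (simp_all add: g, simp add: g_def)
qed

section \<open>The universal inverting ring\<close>

lemma inverting_ideal_ideal:
  assumes "ring R" and "N \<subseteq> carrier R"
  shows "ideal (inverting_ideal R N) (free_ring R N)"
proof -
  interpret F: ring "free_ring R N" by (rule ring_free_ring[OF assms(1)])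
  show ?thesis
    using assms(2) ring_hom_closed[OF free_ring_const_hom[OF assms(1), of N]]
    by (auto simp: inverting_ideal_def Let_def free_ring_var_carrier intro!: F.genideal_ideal)
qed

lemma ring_inverting_ring:
  assumes "ring R" and "N \<subseteq> carrier R"
  shows "ring (inverting_ring R N)"
  unfolding inverting_ring_def
  by (rule ideal.quotient_is_ring[OF inverting_ideal_ideal[OF assms]])

lemma inverting_map_hom:
  assumes "ring R" and "N \<subseteq> carrier R"
  shows "inverting_map R N \<in> ring_hom R (inverting_ring R N)"
  by (rule ring.ring_hom_restrict[OF assms(1) ring_hom_trans[OF free_ring_const_hom[OF assms(1)]
        ideal.rcos_ring_hom[OF inverting_ideal_ideal[OF assms]], folded inverting_ring_def]])
    (simp add: inverting_map_def)

lemma inverting_relations: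
  assumes "ring R" and "N \<subseteq> carrier R" and "n \<in> N"
  defines "L \<equiv> inverting_ring R N"
    and "x \<equiv> inverting_ideal R N +>\<^bsub>free_ring R N\<^esub> free_ring_var R N n"
  shows "x \<in> carrier L"
    and "x \<otimes>\<^bsub>L\<^esub> inverting_map R N n = \<one>\<^bsub>L\<^esub>"
    and "inverting_map R N n \<otimes>\<^bsub>L\<^esub> x = \<one>\<^bsub>L\<^esub>"
proof -
  let ?F = "free_ring R N" and ?I = "inverting_ideal R N"
  let ?c = "free_ring_const R N" and ?v = "free_ring_var R N"
  interpret F: ring ?F by (rule ring_free_ring[OF assms(1)])
  interpret I: ideal ?I ?F by (rule inverting_ideal_ideal[OF assms(1,2)])
  note pi = I.rcos_ring_hom
  have c: "?c m \<in> carrier ?F" if "m \<in> N" for m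
    using that assms(2) ring_hom_closed[OF free_ring_const_hom[OF assms(1)]] by blast
  have v: "?v m \<in> carrier ?F" if "m \<in> N" for m
    using that by (rule free_ring_var_carrier)
  show "x \<in> carrier L"
    using ring_hom_closed[OF pi v[OF assms(3)]] by (simp add: x_def L_def inverting_ring_def)
  let ?G = "{?v n \<otimes>\<^bsub>?F\<^esub> ?c n \<ominus>\<^bsub>?F\<^esub> \<one>\<^bsub>?F\<^esub> | n. n \<in> N} \<union>
           {?c n \<otimes>\<^bsub>?F\<^esub> ?v n \<ominus>\<^bsub>?F\<^esub> \<one>\<^bsub>?F\<^esub> | n. n \<in> N}"
  have "?G \<subseteq> ?I"
    unfolding inverting_ideal_def Let_def by (rule F.genideal_self) (auto simp: c v)
  then have "?v n \<otimes>\<^bsub>?F\<^esub> ?c n \<ominus>\<^bsub>?F\<^esub> \<one>\<^bsub>?F\<^esub> \<in> ?I" "?c n \<otimes>\<^bsub>?F\<^esub> ?v n \<ominus>\<^bsub>?F\<^esub> \<one>\<^bsub>?F\<^esub> \<in> ?I"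
    using assms(3) by blast+
  then have "?I +>\<^bsub>?F\<^esub> (?v n \<otimes>\<^bsub>?F\<^esub> ?c n) = ?I +>\<^bsub>?F\<^esub> \<one>\<^bsub>?F\<^esub>"
      "?I +>\<^bsub>?F\<^esub> (?c n \<otimes>\<^bsub>?F\<^esub> ?v n) = ?I +>\<^bsub>?F\<^esub> \<one>\<^bsub>?F\<^esub>"
    using F.quotient_eq_iff_same_a_r_cos[OF I.is_ideal] c v assms(3) by blast+
  then show "x \<otimes>\<^bsub>L\<^esub> inverting_map R N n = \<one>\<^bsub>L\<^esub>" "inverting_map R N n \<otimes>\<^bsub>L\<^esub> x = \<one>\<^bsub>L\<^esub>"
    using ring_hom_mult[OF pi v c] ring_hom_mult[OF pi c v] ring_hom_one[OF pi] assms(3)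
    by (simp_all add: x_def L_def inverting_ring_def inverting_map_def)
qed

lemma inverting_map_Units:
  assumes "ring R" and "N \<subseteq> carrier R" and "n \<in> N"
  shows "inverting_map R N n \<in> Units (inverting_ring R N)"
proof -
  have "inverting_map R N n \<in> carrier (inverting_ring R N)"
    using assms(2,3) by (intro ring_hom_closed[OF inverting_map_hom[OF assms(1,2)]]) blast
  then show ?thesis
    using inverting_relations[OF assms] unfolding Units_def by blast
qed

text \<open>
  Although \<open>inverting_map R N\<close> need not be surjective, it is an epimorphism: \<open>S\<^bsub>(R,N)\<^esub>\<close> is
  generated by the image of \<open>R\<close> and the inverses \<open>x\<^sub>n\<close> of the images of the elements of \<open>N\<close>, and a
  ring morphism has no freedom in where it sends the inverse of an element.
\<close>

lemma inverting_map_epi: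
  assumes "ring R" and "N \<subseteq> carrier R" and "ring S"
    and "g \<in> ring_hom (inverting_ring R N) S" and "k \<in> ring_hom (inverting_ring R N) S"
    and eq: "\<And>r. r \<in> carrier R \<Longrightarrow> g (inverting_map R N r) = k (inverting_map R N r)"
    and A: "A \<in> carrier (inverting_ring R N)"
  shows "g A = k A"
proof -
  let ?F = "free_ring R N" and ?L = "inverting_ring R N"
  let ?p = "\<lambda>a. inverting_ideal R N +>\<^bsub>?F\<^esub> a"
  interpret S: ring S by fact
  interpret F: ring ?F by (rule ring_free_ring[OF assms(1)])
  have p: "?p \<in> ring_hom ?F ?L"
    unfolding inverting_ring_def
    by (rule ideal.rcos_ring_hom[OF inverting_ideal_ideal[OF assms(1,2)]])
  note chi = inverting_map_hom[OF assms(1,2)]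
  have var: "g (?p (free_ring_var R N n)) = k (?p (free_ring_var R N n))" if n: "n \<in> N" for n
  proof (rule S.inv_unique)
    let ?x = "?p (free_ring_var R N n)" and ?u = "inverting_map R N n"
    note rel = inverting_relations[OF assms(1,2) n]
    have nR: "n \<in> carrier R" and u: "?u \<in> carrier ?L"
      using n assms(2) ring_hom_closed[OF chi] by auto
    show "g ?x \<otimes>\<^bsub>S\<^esub> g ?u = \<one>\<^bsub>S\<^esub>"
      by (simp add: rel ring_hom_one[OF assms(4)] flip: ring_hom_mult[OF assms(4) rel(1) u])
    show "g ?u \<otimes>\<^bsub>S\<^esub> k ?x = \<one>\<^bsub>S\<^esub>"
      by (simp add: eq[OF nR] rel ring_hom_one[OF assms(5)]
          flip: ring_hom_mult[OF assms(5) u rel(1)])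
  qed (use n assms(2) inverting_relations(1)[OF assms(1,2)] ring_hom_closed[OF chi]
      ring_hom_closed[OF assms(4)] ring_hom_closed[OF assms(5)] in auto)
  \<comment> \<open>Restricting to the carrier puts both pullbacks to the free ring in the form in which the
    universal property of the free ring asserts uniqueness.\<close>
  have pull: "restrict (h \<circ> ?p) (carrier ?F) \<in> ring_hom ?F S" if "h \<in> ring_hom ?L S" for h
    by (rule F.ring_hom_restrict[OF ring_hom_trans[OF p that]]) simp
  have const: "?p (free_ring_const R N r) = inverting_map R N r" for r
    by (simp add: inverting_map_def)
  note cv = ring_hom_closed[OF free_ring_const_hom[OF assms(1), of N]] free_ring_var_carrier
  have psi: "k \<circ> inverting_map R N \<in> ring_hom R S"
    by (rule ring_hom_trans[OF chi assms(5)])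
  have zeta: "(\<lambda>n. k (?p (free_ring_var R N n))) \<in> N \<rightarrow> carrier S"
    using ring_hom_closed[OF assms(5)] inverting_relations(1)[OF assms(1,2)] by auto
  have "restrict (g \<circ> ?p) (carrier ?F) = restrict (k \<circ> ?p) (carrier ?F)"
    by (rule Uniq_D[OF conjunct2[OF iffD1[OF ex1_iff_ex_Uniq
            free_ring_universal[OF assms(1,3) psi zeta]]]])
      (auto simp: pull assms(4,5) cv const eq var)
  then have restr: "restrict (g \<circ> ?p) (carrier ?F) a = restrict (k \<circ> ?p) (carrier ?F) a" for a
    by (rule fun_cong)
  obtain a where "a \<in> carrier ?F" "A = ?p a"
    using A unfolding inverting_ring_def by (rule quotient_carrierE)
  then show ?thesis
    using restr[of a] by simp
qed

theorem inverting_ring_universal: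
  assumes "ring R" and "N \<subseteq> carrier R" and "ring S" and "f \<in> ring_hom R S"
    and units: "\<And>n. n \<in> N \<Longrightarrow> f n \<in> Units S"
  shows "\<exists>!g. g \<in> ring_hom (inverting_ring R N) S \<inter> extensional (carrier (inverting_ring R N)) \<and>
    (\<forall>r\<in>carrier R. g (inverting_map R N r) = f r)"
proof -
  let ?F = "free_ring R N" and ?I = "inverting_ideal R N" and ?L = "inverting_ring R N"
  let ?c = "free_ring_const R N" and ?v = "free_ring_var R N"
  interpret S: ring S by fact
  interpret F: ring ?F by (rule ring_free_ring[OF assms(1)])
  have "(\<lambda>n. inv\<^bsub>S\<^esub> f n) \<in> N \<rightarrow> carrier S"
    using units by auto
  from free_ring_universal[OF assms(1,3,4) this]
  obtain h where h: "h \<in> ring_hom ?F S"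
    and hc: "\<And>r. r \<in> carrier R \<Longrightarrow> h (?c r) = f r"
    and hv: "\<And>n. n \<in> N \<Longrightarrow> h (?v n) = inv\<^bsub>S\<^esub> f n"
    by blast
  interpret h: ring_hom_ring ?F S h
    by (rule ring_hom_ringI2[OF F.ring_axioms assms(3) h])
  have c: "?c n \<in> carrier ?F" if "n \<in> N" for n
    using that assms(2) ring_hom_closed[OF free_ring_const_hom[OF assms(1)]] by blast
  have ker: "a \<ominus>\<^bsub>?F\<^esub> \<one>\<^bsub>?F\<^esub> \<in> a_kernel ?F S h"
    if "a \<in> carrier ?F" "h a = \<one>\<^bsub>S\<^esub>" for a
    using that unfolding a_kernel_def' by (simp add: a_minus_def S.r_neg)
  have "h (?v n \<otimes>\<^bsub>?F\<^esub> ?c n) = \<one>\<^bsub>S\<^esub>" "h (?c n \<otimes>\<^bsub>?F\<^esub> ?v n) = \<one>\<^bsub>S\<^esub>" if "n \<in> N" for n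
    using that units[OF that] assms(2) c free_ring_var_carrier[of n N R]
    by (simp_all add: hc hv subset_iff)
  then have "?I \<subseteq> a_kernel ?F S h"
    unfolding inverting_ideal_def Let_def
    by (intro F.genideal_minimal h.kernel_is_ideal)
      (auto intro!: ker simp: c free_ring_var_carrier)
  from ex1_implies_ex[OF h.quotient_universal[OF inverting_ideal_ideal[OF assms(1,2)] this]]
  obtain g where g: "g \<in> ring_hom ?L S" "g \<in> extensional (carrier ?L)"
    and gh: "\<And>a. a \<in> carrier ?F \<Longrightarrow> g (?I +>\<^bsub>?F\<^esub> a) = h a"
    by (auto simp: inverting_ring_def)
  have gf: "g (inverting_map R N r) = f r" if "r \<in> carrier R" for r
    using gh[OF ring_hom_closed[OF free_ring_const_hom[OF assms(1)] that]] hc[OF that]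
    by (simp only: inverting_map_def)
  show ?thesis
  proof (rule ex1I[of _ g])
    fix k
    assume k: "k \<in> ring_hom ?L S \<inter> extensional (carrier ?L) \<and>
      (\<forall>r\<in>carrier R. k (inverting_map R N r) = f r)"
    show "k = g"
      by (rule extensionalityI[of _ "carrier ?L"])
        (use k g gf in \<open>auto intro: inverting_map_epi[OF assms(1-3)]\<close>)
  qed (use g gf in blast)
qed

section \<open>Killing an ideal and inverting a set\<close>

text \<open>
  The two universal properties compose because \<open>R \<rightarrow> R/I\<close> is surjective: prescribing a morphism on
  the image of \<open>R/I\<close> is the same as prescribing it on the image of \<open>R\<close>.
\<close>

lemma quotient_inverting_universal:
  fixes R (structure)
  assumes "ideal I R" and "M \<subseteq> carrier R" and "ring S" and "f \<in> ring_hom R S"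
    and "I \<subseteq> a_kernel R S f" and units: "\<And>m. m \<in> M \<Longrightarrow> f m \<in> Units S"
  defines "Q \<equiv> R Quot I" and "N \<equiv> (\<lambda>m. I +> m) ` M"
  shows "\<exists>!g. g \<in> ring_hom (inverting_ring Q N) S \<inter> extensional (carrier (inverting_ring Q N)) \<and>
    (\<forall>r\<in>carrier R. g (inverting_map Q N (I +> r)) = f r)"
proof -
  interpret I: ideal I R by fact
  interpret f: ring_hom_ring R S f
    by (rule ring_hom_ringI2[OF I.ring_axioms assms(3,4)])
  have pi: "\<And>r. r \<in> carrier R \<Longrightarrow> I +> r \<in> carrier Q"
    unfolding Q_def by (rule ring_hom_closed[OF I.rcos_ring_hom])
  obtain f' where f': "f' \<in> ring_hom Q S" "\<And>r. r \<in> carrier R \<Longrightarrow> f' (I +> r) = f r"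
    using ex1_implies_ex[OF f.quotient_universal[OF assms(1,5)]] by (auto simp: Q_def)
  have "f' n \<in> Units S" if "n \<in> N" for n
    using that assms(2) units f'(2) by (auto simp: N_def)
  moreover have "N \<subseteq> carrier Q"
    using assms(2) pi by (auto simp: N_def)
  ultimately have "\<exists>!g. g \<in> ring_hom (inverting_ring Q N) S \<inter> extensional (carrier (inverting_ring Q N)) \<and>
      (\<forall>q\<in>carrier Q. g (inverting_map Q N q) = f' q)"
    using I.quotient_is_ring[folded Q_def] assms(3) f'(1) by (intro inverting_ring_universal)
  moreover have "(\<forall>q\<in>carrier Q. g (inverting_map Q N q) = f' q) \<longleftrightarrow>
      (\<forall>r\<in>carrier R. g (inverting_map Q N (I +> r)) = f r)" for g
    using pi f'(2) by (auto simp: Q_def elim!: quotient_carrierE)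
  ultimately show ?thesis
    by simp
qed

theorem theorem3p3:
  fixes R :: "('a, 'm) ring_scheme" and \<aa> M :: "'a set"
  assumes "nonzero_ring R"
    and "(\<aa>, M) \<in> Hom_pairs TYPE('b) R"
  shows "let Q = R Quot \<aa>;
             N = (\<lambda>m. \<aa> +>\<^bsub>R\<^esub> m) ` M;
             L = inverting_ring Q N;
             \<psi> = inverting_map Q N \<circ> (\<lambda>r. \<aa> +>\<^bsub>R\<^esub> r)
         in nonzero_ring L \<and>
            a_kernel R L \<psi> = \<aa> \<and>
            \<psi> -` Units L \<inter> carrier R = M \<and>
            (\<forall>(S :: ('c, 'n) ring_scheme) f.
               nonzero_ring S \<and> f \<in> ring_hom R S \<and>
               \<aa> \<subseteq> a_kernel R S f \<and> M \<subseteq> f -` Units S \<inter> carrier R \<longrightarrow>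
               (\<exists>!g. g \<in> ring_hom L S \<inter> extensional (carrier L) \<and>
                     (\<forall>r\<in>carrier R. g (\<psi> r) = f r)))"
proof -
  obtain T :: "'b ring" and \<phi> where T: "ring T" "\<one>\<^bsub>T\<^esub> \<noteq> \<zero>\<^bsub>T\<^esub>" and \<phi>: "\<phi> \<in> ring_hom R T"
    and \<aa>: "\<aa> = a_kernel R T \<phi>" and M: "M = \<phi> -` Units T \<inter> carrier R"
    using assms(2) by (auto simp: Hom_pairs_def nonzero_ring_def)
  interpret R: ring R
    using assms(1) by (simp add: nonzero_ring_def)
  interpret \<phi>: ring_hom_ring R T \<phi>
    by (rule ring_hom_ringI2[OF R.ring_axioms T(1) \<phi>])
  have ideal: "ideal \<aa> R"
    unfolding \<aa> by (rule \<phi>.kernel_is_ideal)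
  interpret I: ideal \<aa> R by (rule ideal)
  have MR: "M \<subseteq> carrier R"
    unfolding M by blast
  define Q N where "Q = R Quot \<aa>" and "N = (\<lambda>m. \<aa> +>\<^bsub>R\<^esub> m) ` M"
  define L \<psi> where "L = inverting_ring Q N" and "\<psi> = inverting_map Q N \<circ> (\<lambda>r. \<aa> +>\<^bsub>R\<^esub> r)"
  have \<pi>: "(\<lambda>r. \<aa> +>\<^bsub>R\<^esub> r) \<in> ring_hom R Q"
    unfolding Q_def by (rule I.rcos_ring_hom)
  have Q: "ring Q"
    unfolding Q_def by (rule I.quotient_is_ring)
  have N: "N \<subseteq> carrier Q"
    using MR ring_hom_closed[OF \<pi>] by (auto simp: N_def)
  interpret L: ring L
    unfolding L_def by (rule ring_inverting_ring[OF Q N])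
  have \<chi>: "inverting_map Q N \<in> ring_hom Q L"
    unfolding L_def by (rule inverting_map_hom[OF Q N])
  have \<psi>: "\<psi> \<in> ring_hom R L"
    unfolding \<psi>_def by (rule ring_hom_trans[OF \<pi> \<chi>])
  \<comment> \<open>The carrier type of \<open>S\<close> stays generic: the fact serves both for the target \<open>T\<close> of the
    morphism that witnesses \<open>(\<aa>, M) \<in> Hom(R)\<close> and for the arbitrary targets in the conclusion.\<close>
  have univ: "\<exists>!g. g \<in> ring_hom L S \<inter> extensional (carrier L) \<and> (\<forall>r\<in>carrier R. g (\<psi> r) = f r)"
    if "ring S" "f \<in> ring_hom R S" "\<aa> \<subseteq> a_kernel R S f" "M \<subseteq> f -` Units S \<inter> carrier R"
    for S :: "('d, 'k) ring_scheme" and f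
    using quotient_inverting_universal[OF ideal MR that(1-3)] that(4)
    by (auto simp: L_def \<psi>_def Q_def N_def)
  obtain g where g: "g \<in> ring_hom L T" and g\<psi>: "\<And>r. r \<in> carrier R \<Longrightarrow> g (\<psi> r) = \<phi> r"
    using ex1_implies_ex[OF univ[OF T(1) \<phi>]] \<aa> M by auto
  have nonzero: "nonzero_ring L"
    using ring_hom_one[OF g] ring_hom_zero[OF g L.ring_axioms T(1)] T(2) L.ring_axioms
    by (auto simp: nonzero_ring_def)
  have kernel: "a_kernel R L \<psi> = \<aa>"
  proof (rule equalityI)
    show "a_kernel R L \<psi> \<subseteq> \<aa>"
      using ring_hom_zero[OF g L.ring_axioms T(1)] unfolding \<aa> a_kernel_def'
      by (auto simp flip: g\<psi>)
    show "\<aa> \<subseteq> a_kernel R L \<psi>"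
    proof (rule subsetI)
      fix r assume r: "r \<in> \<aa>"
      then have "\<aa> +>\<^bsub>R\<^esub> r = \<zero>\<^bsub>Q\<^esub>"
        by (simp add: Q_def FactRing_def I.a_rcos_const)
      then show "r \<in> a_kernel R L \<psi>"
        using I.Icarr[OF r] ring_hom_zero[OF \<chi> Q L.ring_axioms]
        unfolding a_kernel_def' by (simp add: \<psi>_def)
    qed
  qed
  have units: "\<psi> -` Units L \<inter> carrier R = M"
  proof (rule equalityI)
    show "\<psi> -` Units L \<inter> carrier R \<subseteq> M"
    proof (rule subsetI)
      fix r assume "r \<in> \<psi> -` Units L \<inter> carrier R"
      then have "g (\<psi> r) \<in> Units T" and r: "r \<in> carrier R"
        using ring_hom_Units[OF L.ring_axioms T(1) g] by blast+
      then show "r \<in> M"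
        unfolding M g\<psi>[OF r] by blast
    qed
    show "M \<subseteq> \<psi> -` Units L \<inter> carrier R"
    proof (rule subsetI)
      fix m assume m: "m \<in> M"
      then have "\<aa> +>\<^bsub>R\<^esub> m \<in> N"
        unfolding N_def by (rule imageI)
      then have "\<psi> m \<in> Units L"
        unfolding \<psi>_def L_def comp_apply by (rule inverting_map_Units[OF Q N])
      then show "m \<in> \<psi> -` Units L \<inter> carrier R"
        using m MR by blast
    qed
  qed
  show ?thesis
    unfolding Let_def Q_def[symmetric] N_def[symmetric] L_def[symmetric] \<psi>_def[symmetric]
  proof (intro conjI allI impI nonzero kernel units)
    fix S :: "('c, 'n) ring_scheme" and f
    assume "nonzero_ring S \<and> f \<in> ring_hom R S \<and> \<aa> \<subseteq> a_kernel R S f \<and> M \<subseteq> f -` Units S \<inter> carrier R"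
    then show "\<exists>!g. g \<in> ring_hom L S \<inter> extensional (carrier L) \<and> (\<forall>r\<in>carrier R. g (\<psi> r) = f r)"
      by (intro univ) (auto simp: nonzero_ring_def)
  qed
qed

end
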